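(* Let $(\epsilon_1,\epsilon_2)\in\{(-1,-1),(-1,1),(1,-1)\}$ and $\epsilon=-\epsilon_1\epsilon_2$. Let $L$ be the simply connected Lie group with Lie algebra $\mathfrak{l}$ and $\bar g$ the left-invariant metric on $L$ defined by the scalar product $\langle\cdot,\cdot\rangle$ on $\mathfrak{l}$, as given in the context. Then the Levi-Civita connection $\nabla$ of $(L,\bar g)$ is given, on left-invariant vector fields, by $$\begin{aligned} \nabla_{V_2}&=U^2\wedge V_2+\tfrac12U^0\wedge V_0+\tfrac12U^1\wedge V_1,\\ \nabla_{U^2}&=0,\\ \nabla_A&=\tfrac1{\sqrt3}B\wedge A+\tfrac12\epsilon V_0\wedge V_1+\tfrac12\epsilon U^0\wedge U^1+\tfrac1{\sqrt3}\epsilon_2U^1\wedge V_1,\\ \nabla_B&=0,\\ \nabla_{V_0}&=-\tfrac12V_0\wedge U^2-\tfrac12\epsilon_2U^0\wedge V_2+\tfrac{\sqrt3}2V_0\wedge B+\tfrac12\epsilon_1V_1\wedge A,\\ \nabla_{V_1}&=-\tfrac12V_1\wedge U^2-\tfrac12\epsilon U^1\wedge V_2+\tfrac1{2\sqrt3}V_1\wedge B-\tfrac12V_0\wedge A-\tfrac1{\sqrt3}\epsilon_1U^1\wedge A,\\ \nabla_{U^0}&=-\tfrac12U^0\wedge U^2+\tfrac12\epsilon V_0\wedge V_2-\tfrac{\sqrt3}2U^0\wedge B+\tfrac12U^1\wedge A,\\ \nabla_{U^1}&=-\tfrac12U^1\wedge U^2+\tfrac12\epsilon_2V_1\wedge V_2-\tfrac1{2\sqrt3}U^1\wedge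 B-\tfrac12\epsilon_1U^0\wedge A+\tfrac1{\sqrt3}V_1\wedge A. \end{aligned}$$
   Context: The Lie algebra $\mathfrak{l}$ has basis $(T_1,\dots,T_8)=(V_2,U^2,A,B,V_0,V_1,U^0,U^1)$ with brackets (all not determined by these and skew-symmetry vanish): $[B,A]=\frac1{\sqrt3}A$, $[U^2,V_2]=V_2$, $[V_0,U^0]=-V_2$, $[V_1,U^1]=-V_2$, $[U^2,V_I]=\frac12V_I$ and $[U^2,U^I]=\frac12U^I$ for $I=0,1$, $[B,V_0]=-\frac{\sqrt3}2V_0$, $[B,V_1]=-\frac1{2\sqrt3}V_1$, $[B,U^0]=\frac{\sqrt3}2U^0$, $[B,U^1]=\frac1{2\sqrt3}U^1$, $[A,V_0]=V_1$, $[A,U^1]=-U^0$, $[A,V_1]=-\frac2{\sqrt3}U^1$. The scalar product $\langle\cdot,\cdot\rangle$ has Gram matrix $\mathrm{diag}(-\epsilon_1,1,-\epsilon_1,1,-\epsilon,-\epsilon_2,-\epsilon_2,-\epsilon)$ in this basis. Bivectors are identified with skew-symmetric endomorphisms by $(u\wedge v)(w)=u\langle v,w\rangle-\langle u,w\rangle v$. Elements of $\mathfrak{l}$ are identified with left-invariant vector fields on $L$, and for $X\in\mathfrak{l}$, $\nabla_X$ is regarded as the endomorphism $Y\mapsto\nabla_XY$ of $\mathfrak{l}$. *)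

theory Defs
  imports "HOL-Analysis.Analysis"
begin

text \<open>To be used on open sets only. In finite dimension, being differentiable with all directional
  derivatives of class $C^k$ is the same as being of class $C^{k+1}$.\<close>

primrec Ck_on :: "nat \<Rightarrow> 'e::euclidean_space set \<Rightarrow> ('e \<Rightarrow> 'f::euclidean_space) \<Rightarrow> bool" where
  "Ck_on 0 U f \<longleftrightarrow> continuous_on U f"
| "Ck_on (Suc k) U f \<longleftrightarrow>
     f differentiable_on U \<and> (\<forall>v. Ck_on k U (\<lambda>x. frechet_derivative f (at x) v))"

definition smooth_on :: "'e::euclidean_space set \<Rightarrow> ('e \<Rightarrow> 'f::euclidean_space) \<Rightarrow> bool" where
  "smooth_on U f \<longleftrightarrow> (\<forall>k. Ck_on k U f)"

text \<open>The underlying set of a manifold is a whole type, with the topology of that type. A chart is a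
  pair of an open set \<open>U\<close> and a map that is relevant on \<open>U\<close> only.\<close>

type_synonym ('a, 'e) chart = "'a set \<times> ('a \<Rightarrow> 'e)"

definition smooth_atlas ::
  "('a::{t2_space,second_countable_topology}, 'e::euclidean_space) chart set \<Rightarrow> bool" where
  "smooth_atlas \<A> \<longleftrightarrow>
     (\<Union>(U, \<phi>)\<in>\<A>. U) = UNIV \<and>
     (\<forall>(U, \<phi>)\<in>\<A>. open U \<and> open (\<phi> ` U) \<and> homeomorphism U (\<phi> ` U) \<phi> (inv_into U \<phi>)) \<and>
     (\<forall>(U, \<phi>)\<in>\<A>. \<forall>(V, \<psi>)\<in>\<A>. smooth_on (\<phi> ` (U \<inter> V)) (\<psi> \<circ> inv_into U \<phi>))"

definition smooth_map ::
  "('a::topological_space, 'e::euclidean_space) chart set \<Rightarrow>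
   ('b::topological_space, 'f::euclidean_space) chart set \<Rightarrow> ('a \<Rightarrow> 'b) \<Rightarrow> bool" where
  "smooth_map \<A> \<B> F \<longleftrightarrow>
     continuous_on UNIV F \<and>
     (\<forall>(U, \<phi>)\<in>\<A>. \<forall>(V, \<psi>)\<in>\<B>. smooth_on (\<phi> ` (U \<inter> F -` V)) (\<psi> \<circ> F \<circ> inv_into U \<phi>))"

definition prod_atlas ::
  "('a, 'e) chart set \<Rightarrow> ('b, 'f) chart set \<Rightarrow> ('a \<times> 'b, 'e \<times> 'f) chart set" where
  "prod_atlas \<A> \<B> = {(U \<times> V, map_prod \<phi> \<psi>) | U \<phi> V \<psi>. (U, \<phi>) \<in> \<A> \<and> (V, \<psi>) \<in> \<B>}"

definition smooth_functions ::
  "('a::topological_space, 'e::euclidean_space) chart set \<Rightarrow> ('a \<Rightarrow> real) set" where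
  "smooth_functions \<A> = {f. smooth_map \<A> {(UNIV, \<lambda>x::real. x)} f}"

text \<open>A tangent vector at \<open>p\<close> is the functional sending a smooth function \<open>f\<close> to the directional
  derivative of its coordinate expression in a direction \<open>v\<close>, that is
  \<open>\<Sum>i. v\<^sub>i \<cdot> \<partial>f/\<partial>x\<^sub>i\<close> at \<open>p\<close>. It is made \<open>0\<close> on non-smooth functions, so that equal tangent
  vectors are equal as HOL functions.\<close>

type_synonym 'a tvec = "('a \<Rightarrow> real) \<Rightarrow> real"
type_synonym 'a vfield = "'a \<Rightarrow> 'a tvec"

definition chart_vector ::
  "('a::topological_space, 'e::euclidean_space) chart set \<Rightarrow> ('a, 'e) chart \<Rightarrow> 'a \<Rightarrow> 'e \<Rightarrow> 'a tvec" where
  "chart_vector \<A> c p v = (\<lambda>f. if f \<in> smooth_functions \<A>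
     then frechet_derivative (f \<circ> inv_into (fst c) (snd c)) (at (snd c p)) v else 0)"

definition tangent_space ::
  "('a::topological_space, 'e::euclidean_space) chart set \<Rightarrow> 'a \<Rightarrow> 'a tvec set" where
  "tangent_space \<A> p = {chart_vector \<A> c p v | c v. c \<in> \<A> \<and> p \<in> fst c}"

definition push_forward ::
  "('a::topological_space, 'e::euclidean_space) chart set \<Rightarrow> ('a \<Rightarrow> 'a) \<Rightarrow> 'a tvec \<Rightarrow> 'a tvec" where
  "push_forward \<A> F u = (\<lambda>f. if f \<in> smooth_functions \<A> then u (f \<circ> F) else 0)"

definition vector_fields ::
  "('a::topological_space, 'e::euclidean_space) chart set \<Rightarrow> 'a vfield set" where
  "vector_fields \<A> = {X. (\<forall>p. X p \<in> tangent_space \<A> p) \<and>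
     (\<forall>f\<in>smooth_functions \<A>. (\<lambda>p. X p f) \<in> smooth_functions \<A>)}"

definition vf_add :: "'a vfield \<Rightarrow> 'a vfield \<Rightarrow> 'a vfield" where
  "vf_add X Y = (\<lambda>p f. X p f + Y p f)"

definition vf_scale :: "('a \<Rightarrow> real) \<Rightarrow> 'a vfield \<Rightarrow> 'a vfield" where
  "vf_scale h X = (\<lambda>p f. h p * X p f)"

definition vf_diff :: "'a vfield \<Rightarrow> 'a vfield \<Rightarrow> 'a vfield" where
  "vf_diff X Y = (\<lambda>p f. X p f - Y p f)"

definition vf_bracket :: "'a vfield \<Rightarrow> 'a vfield \<Rightarrow> 'a vfield" where
  "vf_bracket X Y = (\<lambda>p f. X p (\<lambda>q. Y q f) - Y p (\<lambda>q. X q f))"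

type_synonym 'a metric_field = "'a \<Rightarrow> 'a tvec \<Rightarrow> 'a tvec \<Rightarrow> real"

definition pseudo_riemannian_metric ::
  "('a::topological_space, 'e::euclidean_space) chart set \<Rightarrow> 'a metric_field \<Rightarrow> bool" where
  "pseudo_riemannian_metric \<A> g \<longleftrightarrow>
     (\<forall>p. \<forall>u\<in>tangent_space \<A> p. \<forall>v\<in>tangent_space \<A> p. g p u v = g p v u) \<and>
     (\<forall>p. \<forall>u\<in>tangent_space \<A> p. \<forall>v\<in>tangent_space \<A> p. \<forall>w\<in>tangent_space \<A> p. \<forall>a b.
        g p (\<lambda>f. a * u f + b * v f) w = a * g p u w + b * g p v w) \<and>
     (\<forall>p. \<forall>u\<in>tangent_space \<A> p. (\<forall>v\<in>tangent_space \<A> p. g p u v = 0) \<longrightarrow> u = (\<lambda>_. 0)) \<and>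
     (\<forall>X\<in>vector_fields \<A>. \<forall>Y\<in>vector_fields \<A>. (\<lambda>p. g p (X p) (Y p)) \<in> smooth_functions \<A>)"

definition affine_connection ::
  "('a::topological_space, 'e::euclidean_space) chart set \<Rightarrow>
   ('a vfield \<Rightarrow> 'a vfield \<Rightarrow> 'a vfield) \<Rightarrow> bool" where
  "affine_connection \<A> D \<longleftrightarrow>
     (\<forall>X\<in>vector_fields \<A>. \<forall>Y\<in>vector_fields \<A>. D X Y \<in> vector_fields \<A>) \<and>
     (\<forall>X\<in>vector_fields \<A>. \<forall>X'\<in>vector_fields \<A>. \<forall>Y\<in>vector_fields \<A>.
        D (vf_add X X') Y = vf_add (D X Y) (D X' Y)) \<and>
     (\<forall>X\<in>vector_fields \<A>. \<forall>Y\<in>vector_fields \<A>. \<forall>h\<in>smooth_functions \<A>.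
        D (vf_scale h X) Y = vf_scale h (D X Y)) \<and>
     (\<forall>X\<in>vector_fields \<A>. \<forall>Y\<in>vector_fields \<A>. \<forall>Y'\<in>vector_fields \<A>.
        D X (vf_add Y Y') = vf_add (D X Y) (D X Y')) \<and>
     (\<forall>X\<in>vector_fields \<A>. \<forall>Y\<in>vector_fields \<A>. \<forall>h\<in>smooth_functions \<A>.
        D X (vf_scale h Y) = vf_add (vf_scale (\<lambda>p. X p h) Y) (vf_scale h (D X Y)))"

definition levi_civita ::
  "('a::topological_space, 'e::euclidean_space) chart set \<Rightarrow> 'a metric_field \<Rightarrow>
   ('a vfield \<Rightarrow> 'a vfield \<Rightarrow> 'a vfield) \<Rightarrow> bool" where
  "levi_civita \<A> g D \<longleftrightarrow>
     affine_connection \<A> D \<and>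
     (\<forall>X\<in>vector_fields \<A>. \<forall>Y\<in>vector_fields \<A>. vf_diff (D X Y) (D Y X) = vf_bracket X Y) \<and>
     (\<forall>X\<in>vector_fields \<A>. \<forall>Y\<in>vector_fields \<A>. \<forall>Z\<in>vector_fields \<A>. \<forall>p.
        X p (\<lambda>q. g q (Y q) (Z q)) = g p (D X Y p) (Z p) + g p (Y p) (D X Z p))"

text \<open>The class \<^class>\<open>group_add\<close> does not assume commutativity, so that \<open>+\<close> and \<open>0\<close> are the
  multiplication and the neutral element of an arbitrary group.\<close>

definition lie_group ::
  "('a::{t2_space,second_countable_topology,group_add}, 'e::euclidean_space) chart set \<Rightarrow> bool" where
  "lie_group \<A> \<longleftrightarrow>
     smooth_atlas \<A> \<and>
     smooth_map (prod_atlas \<A> \<A>) \<A> (\<lambda>(x, y). x + y) \<and>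
     smooth_map \<A> \<A> uminus"

definition left_invariant_fields ::
  "('a::{topological_space,group_add}, 'e::euclidean_space) chart set \<Rightarrow> 'a vfield set" where
  "left_invariant_fields \<A> =
     {X \<in> vector_fields \<A>. \<forall>a p. X (a + p) = push_forward \<A> (\<lambda>q. a + q) (X p)}"

definition left_invariant_metric ::
  "('a::{topological_space,group_add}, 'e::euclidean_space) chart set \<Rightarrow> 'a metric_field \<Rightarrow> bool" where
  "left_invariant_metric \<A> g \<longleftrightarrow>
     pseudo_riemannian_metric \<A> g \<and>
     (\<forall>a p. \<forall>u\<in>tangent_space \<A> p. \<forall>v\<in>tangent_space \<A> p.
        g (a + p) (push_forward \<A> (\<lambda>q. a + q) u) (push_forward \<A> (\<lambda>q. a + q) v) = g p u v)"

text \<open>\<open>\<Phi>\<close> identifies the Lie algebra \<open>'l\<close> with bracket \<open>br\<close> with the Lie algebra of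
  left-invariant vector fields.\<close>

definition lie_algebra_identification ::
  "('a::{topological_space,group_add}, 'e::euclidean_space) chart set \<Rightarrow>
   ('l \<Rightarrow> 'l \<Rightarrow> 'l::real_vector) \<Rightarrow> ('l \<Rightarrow> 'a vfield) \<Rightarrow> bool" where
  "lie_algebra_identification \<A> br \<Phi> \<longleftrightarrow>
     bij_betw \<Phi> UNIV (left_invariant_fields \<A>) \<and>
     (\<forall>x y. \<Phi> (x + y) = vf_add (\<Phi> x) (\<Phi> y)) \<and>
     (\<forall>a x. \<Phi> (a *\<^sub>R x) = vf_scale (\<lambda>_. a) (\<Phi> x)) \<and>
     (\<forall>x y. \<Phi> (br x y) = vf_bracket (\<Phi> x) (\<Phi> y))"

datatype ix = iV2 | iU2 | iA | iB | iV0 | iV1 | iU0 | iU1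

lemma UNIV_ix: "(UNIV :: ix set) = {iV2, iU2, iA, iB, iV0, iV1, iU0, iU1}"
  by (auto intro: ix.exhaust)

instance ix :: finite
  by standard (simp add: UNIV_ix)

type_synonym lalg = "real ^ ix"

abbreviation eV2 :: lalg where "eV2 \<equiv> axis iV2 1"
abbreviation eU2 :: lalg where "eU2 \<equiv> axis iU2 1"
abbreviation eA :: lalg where "eA \<equiv> axis iA 1"
abbreviation eB :: lalg where "eB \<equiv> axis iB 1"
abbreviation eV0 :: lalg where "eV0 \<equiv> axis iV0 1"
abbreviation eV1 :: lalg where "eV1 \<equiv> axis iV1 1"
abbreviation eU0 :: lalg where "eU0 \<equiv> axis iU0 1"
abbreviation eU1 :: lalg where "eU1 \<equiv> axis iU1 1"

text \<open>The brackets of basis vectors in one of the two orders; the other order is supplied by the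
  skew-symmetrization in \<open>lbracket\<close>.\<close>

fun half_bracket :: "ix \<Rightarrow> ix \<Rightarrow> lalg" where
  "half_bracket iB iA = (1 / sqrt 3) *\<^sub>R eA"
| "half_bracket iU2 iV2 = eV2"
| "half_bracket iV0 iU0 = - eV2"
| "half_bracket iV1 iU1 = - eV2"
| "half_bracket iU2 iV0 = (1 / 2) *\<^sub>R eV0"
| "half_bracket iU2 iV1 = (1 / 2) *\<^sub>R eV1"
| "half_bracket iU2 iU0 = (1 / 2) *\<^sub>R eU0"
| "half_bracket iU2 iU1 = (1 / 2) *\<^sub>R eU1"
| "half_bracket iB iV0 = - (sqrt 3 / 2) *\<^sub>R eV0"
| "half_bracket iB iV1 = - (1 / (2 * sqrt 3)) *\<^sub>R eV1"
| "half_bracket iB iU0 = (sqrt 3 / 2) *\<^sub>R eU0"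
| "half_bracket iB iU1 = (1 / (2 * sqrt 3)) *\<^sub>R eU1"
| "half_bracket iA iV0 = eV1"
| "half_bracket iA iU1 = - eU0"
| "half_bracket iA iV1 = - (2 / sqrt 3) *\<^sub>R eU1"
| "half_bracket _ _ = 0"

definition lbracket :: "lalg \<Rightarrow> lalg \<Rightarrow> lalg" where
  "lbracket x y =
     (\<Sum>i\<in>UNIV. \<Sum>j\<in>UNIV. (x $ i * y $ j) *\<^sub>R (half_bracket i j - half_bracket j i))"

fun gram_diag :: "real \<Rightarrow> real \<Rightarrow> real \<Rightarrow> ix \<Rightarrow> real" where
  "gram_diag e e1 e2 iV2 = - e1"
| "gram_diag e e1 e2 iU2 = 1"
| "gram_diag e e1 e2 iA = - e1"
| "gram_diag e e1 e2 iB = 1"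
| "gram_diag e e1 e2 iV0 = - e"
| "gram_diag e e1 e2 iV1 = - e2"
| "gram_diag e e1 e2 iU0 = - e2"
| "gram_diag e e1 e2 iU1 = - e"

definition lscalar :: "real \<Rightarrow> real \<Rightarrow> real \<Rightarrow> lalg \<Rightarrow> lalg \<Rightarrow> real" where
  "lscalar e e1 e2 x y = (\<Sum>i\<in>UNIV. gram_diag e e1 e2 i * x $ i * y $ i)"

definition wedge ::
  "'l::real_vector \<Rightarrow> ('l \<Rightarrow> 'l \<Rightarrow> real) \<Rightarrow> 'l \<Rightarrow> 'l \<Rightarrow> 'l"
    (\<open>(_ \<^bold>\<and>\<^bsub>_\<^esub> _)\<close> [71, 0, 71] 70) where
  "(u \<^bold>\<and>\<^bsub>s\<^esub> v) w = s v w *\<^sub>R u - s u w *\<^sub>R v"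

end

theory Submission
  imports Defs
begin

text \<open>A left-invariant metric is constant on pairs of left-invariant fields. By a dimension count
  the left-invariant fields span every tangent space, so at each point the Levi-Civita
  connection induces a product on the Lie algebra that is torsion-free and skew for the scalar
  product; as in Koszul's formula, these two properties determine it. The stated formulas are
  skew because every \<open>u \<and> v\<close> is, and they are torsion-free by comparison with the brackets.\<close>

section \<open>Tangent spaces in charts\<close>

lemma smooth_on_imp_differentiable:
  assumes "smooth_on S f" "open S" "x \<in> S"
  shows "f differentiable (at x)"
proof -
  have "Ck_on (Suc 0) S f" using assms(1) unfolding smooth_on_def by blast
  then have "f differentiable_on S" by simp
  then show ?thesis using assms(2,3) differentiable_on_eq_differentiable_at by blast
qed

lemma smooth_function_differentiable_in_chart:
  assumes at: "smooth_atlas \<A>" and c: "(U, \<phi>) \<in> \<A>" and p: "p \<in> U"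
    and f: "f \<in> smooth_functions \<A>"
  shows "(f \<circ> inv_into U \<phi>) differentiable (at (\<phi> p))"
proof (rule smooth_on_imp_differentiable[of "\<phi> ` U"])
  show "smooth_on (\<phi> ` U) (f \<circ> inv_into U \<phi>)"
    using f c unfolding smooth_functions_def smooth_map_def by (fastforce simp: comp_def)
  show "open (\<phi> ` U)" using at c unfolding smooth_atlas_def by fast
qed (use p in auto)

lemma linear_chart_vector:
  assumes at: "smooth_atlas \<A>" and c: "c \<in> \<A>" and p: "p \<in> fst c"
  shows "linear (\<lambda>v. chart_vector \<A> c p v f)"
proof (cases "f \<in> smooth_functions \<A>")
  case True
  have "(f \<circ> inv_into (fst c) (snd c)) differentiable (at (snd c p))"
    using smooth_function_differentiable_in_chart[OF at _ p True] c by simp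
  then show ?thesis
    using True linear_frechet_derivative unfolding chart_vector_def by simp
qed (simp add: chart_vector_def linear_zero)

text \<open>This is the chain rule: the expression of \<open>f\<close> in the chart
  \<open>\<psi>\<close> is its expression in \<open>\<phi>\<close> composed with the transition map,
  so components transform by the derivative of that map.\<close>

lemma chart_vector_change_chart:
  assumes at: "smooth_atlas \<A>" and c: "(U, \<phi>) \<in> \<A>" "p \<in> U" and d: "(V, \<psi>) \<in> \<A>" "p \<in> V"
  shows "chart_vector \<A> (V, \<psi>) p v =
    chart_vector \<A> (U, \<phi>) p (frechet_derivative (\<phi> \<circ> inv_into V \<psi>) (at (\<psi> p)) v)"
proof
  fix f
  show "chart_vector \<A> (V, \<psi>) p v f =
    chart_vector \<A> (U, \<phi>) p (frechet_derivative (\<phi> \<circ> inv_into V \<psi>) (at (\<psi> p)) v) f"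
  proof (cases "f \<in> smooth_functions \<A>")
    case True
    let ?\<tau> = "\<phi> \<circ> inv_into V \<psi>" and ?f = "f \<circ> inv_into U \<phi>"
    have U: "open U" "homeomorphism U (\<phi> ` U) \<phi> (inv_into U \<phi>)"
      and V: "open V" "open (\<psi> ` V)" "homeomorphism V (\<psi> ` V) \<psi> (inv_into V \<psi>)"
      and tr: "smooth_on (\<psi> ` (V \<inter> U)) ?\<tau>"
      using at c d unfolding smooth_atlas_def by fast+
    \<comment> \<open>Smoothness of the transition map yields a derivative at
      \<open>\<psi> p\<close> only on an open set, so the chart image of the overlap is first shown
      to be open.\<close>
    have "openin (top_of_set (\<psi> ` V)) (\<psi> ` (V \<inter> U))"
      by (rule homeomorphism_imp_open_map[OF V(3)]) (simp add: U(1) openin_open_Int)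
    then have op: "open (\<psi> ` (V \<inter> U))" using V(2) openin_open_eq by blast
    have mem: "\<psi> p \<in> \<psi> ` (V \<inter> U)" using c d by blast
    have inv\<phi>: "inv_into U \<phi> (\<phi> q) = q" if "q \<in> U" for q
      using U(2) that unfolding homeomorphism_def by blast
    have inv\<psi>: "inv_into V \<psi> (\<psi> q) = q" if "q \<in> V" for q
      using V(3) that unfolding homeomorphism_def by blast
    have "(?\<tau> has_derivative frechet_derivative ?\<tau> (at (\<psi> p))) (at (\<psi> p))"
      using smooth_on_imp_differentiable[OF tr op mem] frechet_derivative_works by blast
    moreover have "(?f has_derivative frechet_derivative ?f (at (\<phi> p))) (at (?\<tau> (\<psi> p)))"
      using smooth_function_differentiable_in_chart[OF at c True]
      by (simp add: inv\<psi> d frechet_derivative_works[symmetric])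
    ultimately have "((?f \<circ> ?\<tau>) has_derivative
        frechet_derivative ?f (at (\<phi> p)) \<circ> frechet_derivative ?\<tau> (at (\<psi> p))) (at (\<psi> p))"
      by (rule diff_chain_at)
    \<comment> \<open>\<open>inv_into U \<phi>\<close> undoes \<open>\<phi>\<close> only on
      \<open>U\<close>, so the two expressions are compared on the image of the overlap. Agreement
      on this open neighbourhood of \<open>\<psi> p\<close> suffices for the derivative.\<close>
    moreover have "(?f \<circ> ?\<tau>) y = (f \<circ> inv_into V \<psi>) y" if "y \<in> \<psi> ` (V \<inter> U)" for y
      using that by (auto simp: inv\<phi> inv\<psi>)
    ultimately have "((f \<circ> inv_into V \<psi>) has_derivative
        frechet_derivative ?f (at (\<phi> p)) \<circ> frechet_derivative ?\<tau> (at (\<psi> p))) (at (\<psi> p))"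
      by (rule has_derivative_transform_within_open[OF _ op mem])
    from frechet_derivative_at[OF this] show ?thesis
      using True unfolding chart_vector_def by (metis comp_apply fst_conv snd_conv)
  qed (simp add: chart_vector_def)
qed

text \<open>\<open>tangent_space\<close> lets the chart vary with the vector. Change of chart
  rewrites every vector in the single chart \<open>c\<close>, which presents the space as a linear
  image of the model space.\<close>

lemma tangent_space_eq_range_chart_vector:
  assumes at: "smooth_atlas \<A>" and c: "c \<in> \<A>" "p \<in> fst c"
  shows "tangent_space \<A> p = range (chart_vector \<A> c p)"
proof
  show "tangent_space \<A> p \<subseteq> range (chart_vector \<A> c p)"
  proof
    fix u assume "u \<in> tangent_space \<A> p"
    then obtain d v where d: "d \<in> \<A>" "p \<in> fst d" "u = chart_vector \<A> d p v"
      unfolding tangent_space_def by blast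
    have "u = chart_vector \<A> c p
        (frechet_derivative (snd c \<circ> inv_into (fst d) (snd d)) (at (snd d p)) v)"
      using chart_vector_change_chart[OF at, of "fst c" "snd c" p "fst d" "snd d" v] c d by simp
    then show "u \<in> range (chart_vector \<A> c p)" by blast
  qed
  show "range (chart_vector \<A> c p) \<subseteq> tangent_space \<A> p"
    using c unfolding tangent_space_def by blast
qed

text \<open>A chart writes \<open>F z\<close> as the chart vector of \<open>L z\<close> for some
  linear \<open>L\<close> from \<open>'l\<close> to \<open>'e\<close>. Injectivity of
  \<open>F\<close> passes to \<open>L\<close>, and equal dimensions make \<open>L\<close> onto, so
  every tangent vector is a value of \<open>F\<close>.\<close>

lemma tangent_space_eq_range_if_inj:
  fixes \<A> :: "('a::{t2_space,second_countable_topology}, 'e::euclidean_space) chart set"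
    and F :: "'l::euclidean_space \<Rightarrow> 'a tvec"
  assumes at: "smooth_atlas \<A>"
    and lin: "\<And>f. linear (\<lambda>z. F z f)"
    and tan: "\<And>z. F z \<in> tangent_space \<A> p"
    and inj: "\<And>z. F z = (\<lambda>_. 0) \<Longrightarrow> z = 0"
    and dim: "DIM('l) = DIM('e)"
  shows "tangent_space \<A> p = range F"
proof -
  have "(\<Union>(U, \<phi>)\<in>\<A>. U) = UNIV"
    using at unfolding smooth_atlas_def by (elim conjE)
  then have "p \<in> (\<Union>(U, \<phi>)\<in>\<A>. U)" by (simp only: UNIV_I)
  then obtain c where c: "c \<in> \<A>" "p \<in> fst c" by auto
  note rng = tangent_space_eq_range_chart_vector[OF at c]
  note clin = linear_chart_vector[OF at c]
  obtain v where v: "F b = chart_vector \<A> c p (v b)" for b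
    using tan unfolding rng image_iff by metis
  \<comment> \<open>The coordinates \<open>v b\<close> come from a choice and need not be linear in
    \<open>b\<close>. Only their values on the basis are kept and extended linearly.\<close>
  define L where "L z = (\<Sum>b\<in>Basis. (z \<bullet> b) *\<^sub>R v b)" for z
  have L: "linear L"
    unfolding L_def
    by (auto intro!: linear_compose_sum linearI simp: inner_left_distrib scaleR_left_distrib)
  have FL: "F z = chart_vector \<A> c p (L z)" for z
  proof
    fix f
    have "F z f = F (\<Sum>b\<in>Basis. (z \<bullet> b) *\<^sub>R b) f" by (simp only: euclidean_representation)
    also have "\<dots> = (\<Sum>b\<in>Basis. (z \<bullet> b) *\<^sub>R F b f)"
      by (simp only: linear_sum[OF lin] linear_scale[OF lin])
    also have "\<dots> = chart_vector \<A> c p (L z) f"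
      by (simp only: L_def linear_sum[OF clin] linear_scale[OF clin] v)
    finally show "F z f = chart_vector \<A> c p (L z) f" .
  qed
  have "inj L"
  proof (subst linear_injective_0[OF L], intro allI impI)
    fix z assume "L z = 0"
    then have "F z = (\<lambda>_. 0)" using FL linear_0[OF clin] by auto
    then show "z = 0" by (rule inj)
  qed
  then have "dim (range L) = DIM('e)"
    using dim_image_eq[OF L, of UNIV] dim by (simp add: inj_on_subset)
  then have "range L = UNIV"
    using dim_eq_full[of "range L"] L linear_subspace_image[OF L subspace_UNIV]
    by (metis span_eq_iff)
  moreover have "range F = chart_vector \<A> c p ` range L"
    unfolding image_image FL[symmetric] ..
  ultimately show ?thesis using rng by simp
qed

section \<open>The Levi-Civita connection on left-invariant fields\<close>

lemma tangent_vector_const: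
  assumes "u \<in> tangent_space \<A> p"
  shows "u (\<lambda>_. k) = 0"
  \<comment> \<open>The coordinate expression of a constant has derivative 0, and the other branch
    of \<open>chart_vector\<close> is 0 by convention.\<close>
  using assms by (auto simp: tangent_space_def chart_vector_def comp_def)

text \<open>\<open>h x y z\<close> plays the role of the difference of two torsion-free metric connections.\<close>

lemma sym_skew_eq_0:
  fixes h :: "'l \<Rightarrow> 'l \<Rightarrow> 'l \<Rightarrow> real"
  assumes "\<And>x y z. h x y z = h y x z" and "\<And>x y z. h x y z = - h x z y"
  shows "h x y z = 0"
  \<comment> \<open>Alternating the two rules runs through all six orders of \<open>x\<close>,
    \<open>y\<close>, \<open>z\<close> and returns after three sign changes, so
    \<open>h x y z\<close> equals its own negative.\<close>
  using assms(1)[of x y z] assms(2)[of y x z] assms(1)[of y z x] assms(2)[of z y x]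
    assms(1)[of z x y] assms(2)[of x z y] by linarith

text \<open>At each point \<open>D\<close> induces a product on \<open>'l\<close> with the same
  torsion and skewness as \<open>N\<close>. The difference of the two is symmetric in the first two
  slots and skew in the last two, hence zero. A candidate formula \<open>N\<close> thus has to be
  checked for two algebraic properties only.\<close>

lemma levi_civita_left_invariant_eqI:
  fixes \<A> :: "('a::{t2_space,second_countable_topology,group_add}, 'e::euclidean_space) chart set"
    and br N :: "'l::euclidean_space \<Rightarrow> 'l \<Rightarrow> 'l"
  assumes at: "smooth_atlas \<A>"
    and id: "lie_algebra_identification \<A> br \<Phi>"
    and inv: "left_invariant_metric \<A> g"
    and s: "\<And>x y. g 0 (\<Phi> x 0) (\<Phi> y 0) = s x y"
    and lc: "levi_civita \<A> g D"
    and dim: "DIM('l) = DIM('e)"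
    and nondeg: "\<And>x. (\<And>y. s x y = 0) \<Longrightarrow> x = 0"
    and torsion: "\<And>x y. N x y - N y x = br x y"
    and skew: "\<And>x y z. s (N x y) z = - s (N x z) y"
  shows "D (\<Phi> x) (\<Phi> y) = \<Phi> (N x y)"
proof
  fix p
  have \<Phi>: "\<Phi> x \<in> vector_fields \<A>" for x
    using id unfolding lie_algebra_identification_def left_invariant_fields_def bij_betw_def by blast
  have push: "\<Phi> x p = push_forward \<A> (\<lambda>q. p + q) (\<Phi> x 0)" for x p
  proof -
    have "\<Phi> x (p + 0) = push_forward \<A> (\<lambda>q. p + q) (\<Phi> x 0)"
      using id unfolding lie_algebra_identification_def left_invariant_fields_def bij_betw_def by blast
    then show ?thesis by simp
  qed
  have tan: "X p \<in> tangent_space \<A> p" if "X \<in> vector_fields \<A>" for X p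
    using that unfolding vector_fields_def by blast
  \<comment> \<open>Translation by \<open>p\<close> carries the values at the neutral element to
    those at \<open>p\<close> and preserves \<open>g\<close>.\<close>
  have gs: "g p (\<Phi> x p) (\<Phi> y p) = s x y" for x y p
  proof -
    have "g (p + 0) (push_forward \<A> (\<lambda>q. p + q) (\<Phi> x 0)) (push_forward \<A> (\<lambda>q. p + q) (\<Phi> y 0))
        = g 0 (\<Phi> x 0) (\<Phi> y 0)"
      using inv tan[OF \<Phi>] unfolding left_invariant_metric_def by blast
    then show ?thesis using push[of x p] push[of y p] s by simp
  qed
  have pr: "pseudo_riemannian_metric \<A> g"
    using inv unfolding left_invariant_metric_def by blast
  have lin\<Phi>: "linear (\<lambda>z. \<Phi> z p f)" for p f
    using id unfolding lie_algebra_identification_def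
    by (auto intro!: linearI simp: vf_add_def vf_scale_def)
  \<comment> \<open>Symmetry and bilinearity of \<open>s\<close> are inherited from \<open>g\<close>
    at the neutral element.\<close>
  have s_comm: "s x y = s y x" for x y
    using pr tan[OF \<Phi>] gs[of 0] unfolding pseudo_riemannian_metric_def by metis
  have s_lin: "s (a *\<^sub>R x + b *\<^sub>R y) z = a * s x z + b * s y z" for a b x y z
  proof -
    have "\<Phi> (a *\<^sub>R x + b *\<^sub>R y) 0 = (\<lambda>f. a * \<Phi> x 0 f + b * \<Phi> y 0 f)"
      using linear_add[OF lin\<Phi>] linear_scale[OF lin\<Phi>] by auto
    moreover have "g 0 (\<lambda>f. a * \<Phi> x 0 f + b * \<Phi> y 0 f) (\<Phi> z 0)
        = a * g 0 (\<Phi> x 0) (\<Phi> z 0) + b * g 0 (\<Phi> y 0) (\<Phi> z 0)"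
      using pr tan[OF \<Phi>] unfolding pseudo_riemannian_metric_def by blast
    ultimately show ?thesis by (metis s)
  qed
  have s_diff: "s (x - y) z = s x z - s y z" for x y z
    using s_lin[of 1 x "-1" y z] by simp
  \<comment> \<open>If \<open>\<Phi> z\<close> vanishes at \<open>p\<close>, then by
    \<open>gs\<close> the vector \<open>z\<close> has the same pairings as 0, and nondegeneracy
    applies.\<close>
  have inj: "z = 0" if "\<Phi> z p = (\<lambda>_. 0)" for z
  proof (rule nondeg)
    fix y
    have "\<Phi> 0 p = (\<lambda>_. 0)" using linear_0[OF lin\<Phi>] by auto
    then have "s z y = s 0 y" using gs that by metis
    then show "s z y = 0" using s_lin[of 0 0 0 0 y] by simp
  qed
  have span: "tangent_space \<A> p = range (\<lambda>z. \<Phi> z p)"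
    by (rule tangent_space_eq_range_if_inj[OF at lin\<Phi> tan[OF \<Phi>] inj dim])
  have D_closed: "\<forall>X\<in>vector_fields \<A>. \<forall>Y\<in>vector_fields \<A>. D X Y \<in> vector_fields \<A>"
    using lc unfolding levi_civita_def affine_connection_def by (elim conjE)
  have D_torsion: "\<forall>X\<in>vector_fields \<A>. \<forall>Y\<in>vector_fields \<A>.
      vf_diff (D X Y) (D Y X) = vf_bracket X Y"
    using lc unfolding levi_civita_def by (elim conjE)
  have D_metric: "\<forall>X\<in>vector_fields \<A>. \<forall>Y\<in>vector_fields \<A>. \<forall>Z\<in>vector_fields \<A>. \<forall>p.
      X p (\<lambda>q. g q (Y q) (Z q)) = g p (D X Y p) (Z p) + g p (Y p) (D X Z p)"
    using lc unfolding levi_civita_def by (elim conjE)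
  have DV: "D (\<Phi> x) (\<Phi> y) \<in> vector_fields \<A>" for x y
    using D_closed \<Phi> by blast
  then have "\<exists>z. D (\<Phi> x) (\<Phi> y) p = \<Phi> z p" for x y
    using span tan[OF DV] by (metis (no_types, lifting) imageE)
  \<comment> \<open>Left-invariance of \<open>D (\<Phi> x) (\<Phi> y)\<close> is not known at this
    stage, so only its value at the fixed \<open>p\<close> is expanded, and \<open>C\<close> may
    depend on \<open>p\<close>. The identification with \<open>N\<close> removes this
    dependence.\<close>
  then obtain C where C: "D (\<Phi> x) (\<Phi> y) p = \<Phi> (C x y) p" for x y by metis
  have C_torsion: "C x y - C y x = br x y" for x y
  proof -
    have "vf_diff (D (\<Phi> x) (\<Phi> y)) (D (\<Phi> y) (\<Phi> x)) = \<Phi> (br x y)"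
      using D_torsion \<Phi> id unfolding lie_algebra_identification_def by metis
    then have "\<Phi> (br x y) p = (\<lambda>f. \<Phi> (C x y) p f - \<Phi> (C y x) p f)"
      unfolding vf_diff_def using C by metis
    then have "\<Phi> (C x y - C y x - br x y) p = (\<lambda>_. 0)"
      using linear_diff[OF lin\<Phi>] by auto
    then show ?thesis using inj by fastforce
  qed
  have C_skew: "s (C x y) z = - s (C x z) y" for x y z
  proof -
    have "\<Phi> x p (\<lambda>q. g q (\<Phi> y q) (\<Phi> z q)) =
        g p (D (\<Phi> x) (\<Phi> y) p) (\<Phi> z p) + g p (\<Phi> y p) (D (\<Phi> x) (\<Phi> z) p)"
      using D_metric \<Phi> by blast
    \<comment> \<open>By \<open>gs\<close> the function being differentiated is the constant
      \<open>s y z\<close>.\<close>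
    moreover have "\<Phi> x p (\<lambda>q. g q (\<Phi> y q) (\<Phi> z q)) = 0"
      unfolding gs by (rule tangent_vector_const[OF tan[OF \<Phi>]])
    ultimately show ?thesis unfolding C gs using s_comm by (metis add_eq_0_iff2)
  qed
  have "s (C x y - N x y) z = 0" for z
  proof (rule sym_skew_eq_0[where h = "\<lambda>x y z. s (C x y - N x y) z"])
    fix x y z
    have "C x y - N x y = C y x - N y x"
      using C_torsion[of x y] torsion[of x y] unfolding diff_eq_eq by simp
    then show "s (C x y - N x y) z = s (C y x - N y x) z" by simp
    show "s (C x y - N x y) z = - s (C x z - N x z) y"
      unfolding s_diff using C_skew[of x y z] skew[of x y z] by simp
  qed
  then have "C x y = N x y" using nondeg by fastforce
  then show "D (\<Phi> x) (\<Phi> y) p = \<Phi> (N x y) p" using C by simp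
qed

section \<open>Explicit computation in the Lie algebra\<close>

lemma sum_ix:
  fixes f :: "ix \<Rightarrow> 'b::comm_monoid_add"
  shows "sum f UNIV = f iV2 + f iU2 + f iA + f iB + f iV0 + f iV1 + f iU0 + f iU1"
  by (simp add: UNIV_ix add.assoc)

lemma all_ix:
  "(\<forall>i. P i) \<longleftrightarrow> P iV2 \<and> P iU2 \<and> P iA \<and> P iB \<and> P iV0 \<and> P iV1 \<and> P iU0 \<and> P iU1"
  by (metis ix.exhaust)

text \<open>With the double sum expanded once, the torsion identity splits into eight scalar
  identities bilinear in \<open>x\<close> and \<open>y\<close>.\<close>

lemma lbracket_nth:
  "lbracket x y $ iV2 = x$iU2 * y$iV2 - x$iV2 * y$iU2 - (x$iV0 * y$iU0 - x$iU0 * y$iV0)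
     - (x$iV1 * y$iU1 - x$iU1 * y$iV1)"
  "lbracket x y $ iU2 = 0"
  "lbracket x y $ iA = (1 / sqrt 3) * (x$iB * y$iA - x$iA * y$iB)"
  "lbracket x y $ iB = 0"
  "lbracket x y $ iV0 = (1/2) * (x$iU2 * y$iV0 - x$iV0 * y$iU2)
     - (sqrt 3 / 2) * (x$iB * y$iV0 - x$iV0 * y$iB)"
  "lbracket x y $ iV1 = (1/2) * (x$iU2 * y$iV1 - x$iV1 * y$iU2)
     - (1 / (2 * sqrt 3)) * (x$iB * y$iV1 - x$iV1 * y$iB) + (x$iA * y$iV0 - x$iV0 * y$iA)"
  "lbracket x y $ iU0 = (1/2) * (x$iU2 * y$iU0 - x$iU0 * y$iU2)
     + (sqrt 3 / 2) * (x$iB * y$iU0 - x$iU0 * y$iB) - (x$iA * y$iU1 - x$iU1 * y$iA)"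
  "lbracket x y $ iU1 = (1/2) * (x$iU2 * y$iU1 - x$iU1 * y$iU2)
     + (1 / (2 * sqrt 3)) * (x$iB * y$iU1 - x$iU1 * y$iB)
     - (2 / sqrt 3) * (x$iA * y$iV1 - x$iV1 * y$iA)"
  unfolding lbracket_def sum_ix by (simp_all add: axis_def algebra_simps)

text \<open>The claimed formulas are extended linearly in the direction \<open>x\<close>, so that
  torsion and skewness can be stated for arbitrary vectors. The coordinates \<open>iU2\<close> and
  \<open>iB\<close> are absent because their claimed endomorphisms are 0.\<close>

definition nabla :: "real \<Rightarrow> real \<Rightarrow> real \<Rightarrow> (lalg \<Rightarrow> lalg \<Rightarrow> real) \<Rightarrow> lalg \<Rightarrow> lalg \<Rightarrow> lalg" where
  "nabla \<epsilon> \<epsilon>\<^sub>1 \<epsilon>\<^sub>2 s x y =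
    x$iV2 *\<^sub>R
      ((eU2 \<^bold>\<and>\<^bsub>s\<^esub> eV2) y + (1/2) *\<^sub>R (eU0 \<^bold>\<and>\<^bsub>s\<^esub> eV0) y + (1/2) *\<^sub>R (eU1 \<^bold>\<and>\<^bsub>s\<^esub> eV1) y) +
    x$iA *\<^sub>R
      ((1 / sqrt 3) *\<^sub>R (eB \<^bold>\<and>\<^bsub>s\<^esub> eA) y + (1/2 * \<epsilon>) *\<^sub>R (eV0 \<^bold>\<and>\<^bsub>s\<^esub> eV1) y
        + (1/2 * \<epsilon>) *\<^sub>R (eU0 \<^bold>\<and>\<^bsub>s\<^esub> eU1) y + (1 / sqrt 3 * \<epsilon>\<^sub>2) *\<^sub>R (eU1 \<^bold>\<and>\<^bsub>s\<^esub> eV1) y) +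
    x$iV0 *\<^sub>R
      (- (1/2) *\<^sub>R (eV0 \<^bold>\<and>\<^bsub>s\<^esub> eU2) y - (1/2 * \<epsilon>\<^sub>2) *\<^sub>R (eU0 \<^bold>\<and>\<^bsub>s\<^esub> eV2) y
        + (sqrt 3 / 2) *\<^sub>R (eV0 \<^bold>\<and>\<^bsub>s\<^esub> eB) y + (1/2 * \<epsilon>\<^sub>1) *\<^sub>R (eV1 \<^bold>\<and>\<^bsub>s\<^esub> eA) y) +
    x$iV1 *\<^sub>R
      (- (1/2) *\<^sub>R (eV1 \<^bold>\<and>\<^bsub>s\<^esub> eU2) y - (1/2 * \<epsilon>) *\<^sub>R (eU1 \<^bold>\<and>\<^bsub>s\<^esub> eV2) y
        + (1 / (2 * sqrt 3)) *\<^sub>R (eV1 \<^bold>\<and>\<^bsub>s\<^esub> eB) y - (1/2) *\<^sub>R (eV0 \<^bold>\<and>\<^bsub>s\<^esub> eA) y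
        - (1 / sqrt 3 * \<epsilon>\<^sub>1) *\<^sub>R (eU1 \<^bold>\<and>\<^bsub>s\<^esub> eA) y) +
    x$iU0 *\<^sub>R
      (- (1/2) *\<^sub>R (eU0 \<^bold>\<and>\<^bsub>s\<^esub> eU2) y + (1/2 * \<epsilon>) *\<^sub>R (eV0 \<^bold>\<and>\<^bsub>s\<^esub> eV2) y
        - (sqrt 3 / 2) *\<^sub>R (eU0 \<^bold>\<and>\<^bsub>s\<^esub> eB) y + (1/2) *\<^sub>R (eU1 \<^bold>\<and>\<^bsub>s\<^esub> eA) y) +
    x$iU1 *\<^sub>R
      (- (1/2) *\<^sub>R (eU1 \<^bold>\<and>\<^bsub>s\<^esub> eU2) y + (1/2 * \<epsilon>\<^sub>2) *\<^sub>R (eV1 \<^bold>\<and>\<^bsub>s\<^esub> eV2) y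
        - (1 / (2 * sqrt 3)) *\<^sub>R (eU1 \<^bold>\<and>\<^bsub>s\<^esub> eB) y - (1/2 * \<epsilon>\<^sub>1) *\<^sub>R (eU0 \<^bold>\<and>\<^bsub>s\<^esub> eA) y
        + (1 / sqrt 3) *\<^sub>R (eV1 \<^bold>\<and>\<^bsub>s\<^esub> eA) y)"

text \<open>Every wedge in \<open>nabla\<close> pairs basis vectors with its argument; orthogonality
  of the basis leaves one coordinate times a diagonal entry.\<close>

lemma lscalar_axis: "lscalar \<epsilon> \<epsilon>\<^sub>1 \<epsilon>\<^sub>2 (axis i 1) y = gram_diag \<epsilon> \<epsilon>\<^sub>1 \<epsilon>\<^sub>2 i * y $ i"
  unfolding lscalar_def
  by (cases i) (simp_all add: sum_ix axis_def)

lemma lscalar_commute: "lscalar \<epsilon> \<epsilon>\<^sub>1 \<epsilon>\<^sub>2 x y = lscalar \<epsilon> \<epsilon>\<^sub>1 \<epsilon>\<^sub>2 y x"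
  unfolding lscalar_def by (simp add: mult_ac)

lemma lscalar_left:
  "lscalar \<epsilon> \<epsilon>\<^sub>1 \<epsilon>\<^sub>2 (x + y) z = lscalar \<epsilon> \<epsilon>\<^sub>1 \<epsilon>\<^sub>2 x z + lscalar \<epsilon> \<epsilon>\<^sub>1 \<epsilon>\<^sub>2 y z"
  "lscalar \<epsilon> \<epsilon>\<^sub>1 \<epsilon>\<^sub>2 (x - y) z = lscalar \<epsilon> \<epsilon>\<^sub>1 \<epsilon>\<^sub>2 x z - lscalar \<epsilon> \<epsilon>\<^sub>1 \<epsilon>\<^sub>2 y z"
  "lscalar \<epsilon> \<epsilon>\<^sub>1 \<epsilon>\<^sub>2 (a *\<^sub>R x) z = a * lscalar \<epsilon> \<epsilon>\<^sub>1 \<epsilon>\<^sub>2 x z"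
  unfolding lscalar_def
  by (simp_all add: sum.distrib sum_subtractf sum_distrib_left algebra_simps)

text \<open>Pairing \<open>u \<and> v\<close> applied to \<open>y\<close> with \<open>z\<close>
  gives \<open>s v y * s u z - s u y * s v z\<close>, which changes sign when \<open>y\<close> and
  \<open>z\<close> are exchanged. Linear combinations keep this property.\<close>

lemma lscalar_nabla_skew:
  fixes \<epsilon> \<epsilon>\<^sub>1 \<epsilon>\<^sub>2
  defines "s \<equiv> lscalar \<epsilon> \<epsilon>\<^sub>1 \<epsilon>\<^sub>2"
  shows "s (nabla \<epsilon> \<epsilon>\<^sub>1 \<epsilon>\<^sub>2 s x y) z = - s (nabla \<epsilon> \<epsilon>\<^sub>1 \<epsilon>\<^sub>2 s x z) y"
  unfolding nabla_def wedge_def s_def lscalar_left by (simp add: algebra_simps)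

lemma lscalar_nondegenerate:
  assumes "\<epsilon> \<noteq> 0" "\<epsilon>\<^sub>1 \<noteq> 0" "\<epsilon>\<^sub>2 \<noteq> 0" and "\<And>y. lscalar \<epsilon> \<epsilon>\<^sub>1 \<epsilon>\<^sub>2 x y = 0"
  shows "x = 0"
proof -
  \<comment> \<open>Pairing with basis vectors isolates the coordinates of \<open>x\<close>.\<close>
  have "gram_diag \<epsilon> \<epsilon>\<^sub>1 \<epsilon>\<^sub>2 i * x $ i = 0" for i
    using assms(4) lscalar_axis lscalar_commute by metis
  moreover have "gram_diag \<epsilon> \<epsilon>\<^sub>1 \<epsilon>\<^sub>2 i \<noteq> 0" for i
    using assms(1-3) by (cases i) auto
  ultimately show ?thesis by (simp add: vec_eq_iff)
qed

lemma nabla_torsion_free: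
  assumes "(\<epsilon>\<^sub>1, \<epsilon>\<^sub>2) \<in> {(-1, -1), (-1, 1), (1, -1)}" and "\<epsilon> = - \<epsilon>\<^sub>1 * \<epsilon>\<^sub>2"
    and s: "s = lscalar \<epsilon> \<epsilon>\<^sub>1 \<epsilon>\<^sub>2"
  shows "nabla \<epsilon> \<epsilon>\<^sub>1 \<epsilon>\<^sub>2 s x y - nabla \<epsilon> \<epsilon>\<^sub>1 \<epsilon>\<^sub>2 s y x = lbracket x y"
proof -
  \<comment> \<open>The identity rests on sign relations such as \<epsilon> squared being 1 and
    \<open>\<epsilon> * \<epsilon>\<^sub>2 = - \<epsilon>\<^sub>1\<close>; substituting the
    numerical values makes them automatic.\<close>
  from assms(1,2) consider "\<epsilon>\<^sub>1 = -1" "\<epsilon>\<^sub>2 = -1" "\<epsilon> = -1" | "\<epsilon>\<^sub>1 = -1" "\<epsilon>\<^sub>2 = 1" "\<epsilon> = 1"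
    | "\<epsilon>\<^sub>1 = 1" "\<epsilon>\<^sub>2 = -1" "\<epsilon> = 1" by auto
  then show ?thesis
    unfolding vec_eq_iff all_ix s lbracket_nth nabla_def wedge_def lscalar_axis
    \<comment> \<open>Splitting the fractions lets equal multiples be collected. For instance, the
      coefficient \<open>- (2 / sqrt 3)\<close> in the bracket of \<open>eA\<close> and
      \<open>eV1\<close> is the sum of one \<open>- (1 / sqrt 3)\<close> from each of the two
      covariant derivatives.\<close>
    by cases (simp_all add: axis_def, simp_all add: algebra_simps add_divide_distrib diff_divide_distrib)
qed

theorem proposition11:
  fixes \<A> :: "('a::{t2_space,second_countable_topology,group_add}, real ^ 8) chart set"
    and \<Phi> :: "lalg \<Rightarrow> 'a vfield"
    and g :: "'a metric_field"
    and D :: "'a vfield \<Rightarrow> 'a vfield \<Rightarrow> 'a vfield"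
    and \<epsilon> \<epsilon>\<^sub>1 \<epsilon>\<^sub>2 :: real
    and s :: "lalg \<Rightarrow> lalg \<Rightarrow> real"
  assumes "(\<epsilon>\<^sub>1, \<epsilon>\<^sub>2) \<in> {(-1, -1), (-1, 1), (1, -1)}"
    and "\<epsilon> = - \<epsilon>\<^sub>1 * \<epsilon>\<^sub>2"
    and "s = lscalar \<epsilon> \<epsilon>\<^sub>1 \<epsilon>\<^sub>2"
    and "lie_group \<A>"
    and "simply_connected (UNIV :: 'a set)"
    and "lie_algebra_identification \<A> lbracket \<Phi>"
    and "left_invariant_metric \<A> g"
    and "\<And>x y. g 0 (\<Phi> x 0) (\<Phi> y 0) = s x y"
    and "levi_civita \<A> g D"
  shows "\<forall>y.
    D (\<Phi> eV2) (\<Phi> y) = \<Phi>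
      ((eU2 \<^bold>\<and>\<^bsub>s\<^esub> eV2) y + (1/2) *\<^sub>R (eU0 \<^bold>\<and>\<^bsub>s\<^esub> eV0) y + (1/2) *\<^sub>R (eU1 \<^bold>\<and>\<^bsub>s\<^esub> eV1) y) \<and>
    D (\<Phi> eU2) (\<Phi> y) = \<Phi> 0 \<and>
    D (\<Phi> eA) (\<Phi> y) = \<Phi>
      ((1 / sqrt 3) *\<^sub>R (eB \<^bold>\<and>\<^bsub>s\<^esub> eA) y + (1/2 * \<epsilon>) *\<^sub>R (eV0 \<^bold>\<and>\<^bsub>s\<^esub> eV1) y
        + (1/2 * \<epsilon>) *\<^sub>R (eU0 \<^bold>\<and>\<^bsub>s\<^esub> eU1) y + (1 / sqrt 3 * \<epsilon>\<^sub>2) *\<^sub>R (eU1 \<^bold>\<and>\<^bsub>s\<^esub> eV1) y) \<and>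
    D (\<Phi> eB) (\<Phi> y) = \<Phi> 0 \<and>
    D (\<Phi> eV0) (\<Phi> y) = \<Phi>
      (- (1/2) *\<^sub>R (eV0 \<^bold>\<and>\<^bsub>s\<^esub> eU2) y - (1/2 * \<epsilon>\<^sub>2) *\<^sub>R (eU0 \<^bold>\<and>\<^bsub>s\<^esub> eV2) y
        + (sqrt 3 / 2) *\<^sub>R (eV0 \<^bold>\<and>\<^bsub>s\<^esub> eB) y + (1/2 * \<epsilon>\<^sub>1) *\<^sub>R (eV1 \<^bold>\<and>\<^bsub>s\<^esub> eA) y) \<and>
    D (\<Phi> eV1) (\<Phi> y) = \<Phi>
      (- (1/2) *\<^sub>R (eV1 \<^bold>\<and>\<^bsub>s\<^esub> eU2) y - (1/2 * \<epsilon>) *\<^sub>R (eU1 \<^bold>\<and>\<^bsub>s\<^esub> eV2) y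
        + (1 / (2 * sqrt 3)) *\<^sub>R (eV1 \<^bold>\<and>\<^bsub>s\<^esub> eB) y - (1/2) *\<^sub>R (eV0 \<^bold>\<and>\<^bsub>s\<^esub> eA) y
        - (1 / sqrt 3 * \<epsilon>\<^sub>1) *\<^sub>R (eU1 \<^bold>\<and>\<^bsub>s\<^esub> eA) y) \<and>
    D (\<Phi> eU0) (\<Phi> y) = \<Phi>
      (- (1/2) *\<^sub>R (eU0 \<^bold>\<and>\<^bsub>s\<^esub> eU2) y + (1/2 * \<epsilon>) *\<^sub>R (eV0 \<^bold>\<and>\<^bsub>s\<^esub> eV2) y
        - (sqrt 3 / 2) *\<^sub>R (eU0 \<^bold>\<and>\<^bsub>s\<^esub> eB) y + (1/2) *\<^sub>R (eU1 \<^bold>\<and>\<^bsub>s\<^esub> eA) y) \<and>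
    D (\<Phi> eU1) (\<Phi> y) = \<Phi>
      (- (1/2) *\<^sub>R (eU1 \<^bold>\<and>\<^bsub>s\<^esub> eU2) y + (1/2 * \<epsilon>\<^sub>2) *\<^sub>R (eV1 \<^bold>\<and>\<^bsub>s\<^esub> eV2) y
        - (1 / (2 * sqrt 3)) *\<^sub>R (eU1 \<^bold>\<and>\<^bsub>s\<^esub> eB) y - (1/2 * \<epsilon>\<^sub>1) *\<^sub>R (eU0 \<^bold>\<and>\<^bsub>s\<^esub> eA) y
        + (1 / sqrt 3) *\<^sub>R (eV1 \<^bold>\<and>\<^bsub>s\<^esub> eA) y)"
proof -
  have eps: "\<epsilon> \<noteq> 0" "\<epsilon>\<^sub>1 \<noteq> 0" "\<epsilon>\<^sub>2 \<noteq> 0"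
    using assms(1,2) by auto
  have "smooth_atlas \<A>"
    using assms(4) unfolding lie_group_def by blast
  \<comment> \<open>\<open>ix\<close> has eight elements, matching the model space of the
    charts.\<close>
  moreover have "DIM(lalg) = DIM(real ^ 8)"
    by (simp add: UNIV_ix)
  ultimately have "D (\<Phi> x) (\<Phi> y) = \<Phi> (nabla \<epsilon> \<epsilon>\<^sub>1 \<epsilon>\<^sub>2 s x y)" for x y
    using levi_civita_left_invariant_eqI[OF _ assms(6,7,8,9)]
      lscalar_nondegenerate[OF eps] nabla_torsion_free[OF assms(1,2,3)] lscalar_nabla_skew
    unfolding assms(3) by blast
  then show ?thesis
    \<comment> \<open>For \<open>x\<close> a basis vector at most one summand of
      \<open>nabla\<close> survives; for \<open>eU2\<close> and \<open>eB\<close> none does, which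
      gives \<open>\<Phi> 0\<close>.\<close>
    by (simp add: nabla_def axis_def)
qed

end
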